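(* Let $q\ge 1$ be an integer and let $T$ be an infinite $(q+1)$-homogeneous tree rooted at $o$. For $1\le p\le\infty$, $\|\cdot\|_p$ induces a Banach space structure on $\mathbb{T}_{p,0}$; that is, $\mathbb{T}_{p,0}$ is a complex vector space (with pointwise operations), $\|\cdot\|_p$ is a norm on it, and $(\mathbb{T}_{p,0},\|\cdot\|_p)$ is complete.
   Context: A $(q+1)$-homogeneous tree is a connected graph without cycles in which every vertex has exactly $q+1$ neighbours; rooted means that a vertex $o$ (the root) is singled out. For a vertex $v$, $|v|$ is the number of edges in the unique path from $o$ to $v$; for $n\ge1$ there are $(q+1)q^{n-1}$ vertices with $|v|=n$. Functions on $T$ are functions on its vertices. $\mathbb{N}=\{1,2,\dots\}$, $\mathbb{N}_0=\mathbb{N}\cup\{0\}$. For $f\colon T\to\mathbb{C}$ and $n\in\mathbb{N}$, $M_p(n,f)=\left(\frac{1}{(q+1)q^{n-1}}\sum_{|v|=n}|f(v)|^p\right)^{1/p}$ if $0<p<\infty$, $M_\infty(n,f)=\max_{|v|=n}|f(v)|$, and $M_p(0,f)=|f(o)|$ for all $p\in(0,\infty]$. Put $\|f\|_p=\sup_{n\in\mathbb{N}_0}M_p(n,f)$, $\mathbb{T}_p=\{f\colon T\to\mathbb{C}:\|f\|_p<\infty\}$ and $\mathbb{T}_{p,0}=\{f\in\mathbb{T}_p:\lim_{n\to\infty}M_p(n,f)=0\}$. *)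

theory Defs
  imports
    "HOL-Analysis.Analysis"
    "HOL-Library.Function_Algebras"
    "Graph_Theory.Digraph_Component"
begin

text \<open>
  Simple graphs are loop-free symmetric digraphs without parallel arcs
  (\<^locale>\<open>pair_bidirected_digraph\<close>, no finiteness assumed).  The predicates \<^const>\<open>forest\<close> and
  \<^const>\<open>tree\<close> of the graph library are not the undirected notions: going along an edge and back
  is already a \<^const>\<open>pre_digraph.cycle\<close> of length 2.  Hence the restriction to length at least 3,
  which gives exactly the cycles of the underlying simple graph.
\<close>

definition undirected_tree :: "'v pair_pre_digraph \<Rightarrow> bool" where
  "undirected_tree T \<longleftrightarrow>
     pair_bidirected_digraph T \<and>
     Digraph_Component.connected (with_proj T) \<and>
     (\<nexists>c. pre_digraph.cycle (with_proj T) c \<and> length c \<ge> 3)"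

text \<open>For positive \<open>d\<close>, the degree condition forces the set of neighbours to be finite.\<close>

definition homogeneous_tree :: "nat \<Rightarrow> 'v pair_pre_digraph \<Rightarrow> bool" where
  "homogeneous_tree d T \<longleftrightarrow>
     undirected_tree T \<and> (\<forall>v \<in> pverts T. out_degree (with_proj T) v = d)"

definition depth :: "'v pair_pre_digraph \<Rightarrow> 'v \<Rightarrow> 'v \<Rightarrow> nat" where
  "depth T r v = (THE n. \<exists>es. pre_digraph.apath (with_proj T) r es v \<and> length es = n)"

definition level :: "'v pair_pre_digraph \<Rightarrow> 'v \<Rightarrow> nat \<Rightarrow> 'v set" where
  "level T r n = {v \<in> pverts T. depth T r v = n}"

text \<open>
  In the next definitions \<open>T\<close> is meant to be a \<open>(q + 1)\<close>-homogeneous tree with root \<open>r\<close>, and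
  \<open>p\<close> ranges over the positive extended reals.
\<close>

definition Mp :: "'v pair_pre_digraph \<Rightarrow> 'v \<Rightarrow> nat \<Rightarrow> ennreal \<Rightarrow> nat \<Rightarrow> ('v \<Rightarrow> complex) \<Rightarrow> real" where
  "Mp T r q p n f =
     (if n = 0 then norm (f r)
      else if p = \<infinity> then Max ((\<lambda>v. norm (f v)) ` level T r n)
      else ((1 / ((real q + 1) * real q ^ (n - 1))) *
             (\<Sum>v \<in> level T r n. norm (f v) powr enn2real p)) powr (1 / enn2real p))"

definition Tnorm :: "'v pair_pre_digraph \<Rightarrow> 'v \<Rightarrow> nat \<Rightarrow> ennreal \<Rightarrow> ('v \<Rightarrow> complex) \<Rightarrow> ennreal" where
  "Tnorm T r q p f = (SUP n. ennreal (Mp T r q p n f))"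

text \<open>
  A function on the vertex set is represented by the total function that extends it by \<open>0\<close>;
  this is compatible with the pointwise operations.
\<close>

definition vertex_functions :: "'v pair_pre_digraph \<Rightarrow> ('v \<Rightarrow> complex) set" where
  "vertex_functions T = {f. \<forall>v. v \<notin> pverts T \<longrightarrow> f v = 0}"

definition Tp :: "'v pair_pre_digraph \<Rightarrow> 'v \<Rightarrow> nat \<Rightarrow> ennreal \<Rightarrow> ('v \<Rightarrow> complex) set" where
  "Tp T r q p = {f \<in> vertex_functions T. Tnorm T r q p f < \<infinity>}"

definition Tp0 :: "'v pair_pre_digraph \<Rightarrow> 'v \<Rightarrow> nat \<Rightarrow> ennreal \<Rightarrow> ('v \<Rightarrow> complex) set" where
  "Tp0 T r q p = {f \<in> Tp T r q p. (\<lambda>n. Mp T r q p n f) \<longlonglongrightarrow> 0}"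

definition norm_on :: "(complex \<Rightarrow> 'b \<Rightarrow> 'b) \<Rightarrow> 'b::ab_group_add set \<Rightarrow> ('b \<Rightarrow> real) \<Rightarrow> bool" where
  "norm_on smul S N \<longleftrightarrow>
     (\<forall>x\<in>S. 0 \<le> N x) \<and>
     (\<forall>x\<in>S. N x = 0 \<longleftrightarrow> x = 0) \<and>
     (\<forall>c. \<forall>x\<in>S. N (smul c x) = norm c * N x) \<and>
     (\<forall>x\<in>S. \<forall>y\<in>S. N (x + y) \<le> N x + N y)"

definition complex_banach_on ::
    "(complex \<Rightarrow> 'b \<Rightarrow> 'b) \<Rightarrow> 'b::ab_group_add set \<Rightarrow> ('b \<Rightarrow> real) \<Rightarrow> bool" where
  "complex_banach_on smul S N \<longleftrightarrow>
     vector_space smul \<and> module.subspace smul S \<and>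
     norm_on smul S N \<and>
     Metric_space.mcomplete S (\<lambda>x y. N (x - y))"

end

theory Submission
  imports Defs
begin

text \<open>
  Two distinct paths with common ends contain a cycle, so in a tree the depth of a vertex is the
  length of its unique path from the root. Hence the levels are finite, and they are nonempty as
  the tree is infinite. On the functions on a fixed level, \<^const>\<open>Mp\<close> is therefore a norm; the
  triangle inequality is Minkowski's. A Cauchy sequence for the supremum of these norms
  converges at every vertex, since its values on a level are controlled by the norm of that level.
  Level norms pass to pointwise limits, so the convergence is uniform over the levels, and
  uniform limits of sequences tending to \<open>0\<close> tend to \<open>0\<close>.
\<close>

section \<open>Uniqueness of paths in a tree\<close>

text \<open>Equal first arcs are stripped by induction. If the first arcs differ, following one path
  up to its first meeting with the other and returning along the other closes a cycle.\<close>

lemma (in pair_bidirected_digraph) apath_unique: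
  assumes acyclic: "\<nexists>c. cycle c \<and> length c \<ge> 3"
    and "apath u p v" "apath u q v"
  shows "p = q"
  using assms(2,3)
proof (induction p arbitrary: u q)
  case Nil
  then show ?case
    using apath_nonempty_ends by (auto simp: apath_Nil_iff)
next
  case (Cons e es)
  then have "u \<noteq> v" using apath_nonempty_ends by blast
  with Cons.prems(2) obtain e' es' where q: "q = e' # es'"
    by (cases q) (auto simp: apath_Nil_iff)
  from Cons.prems(1) have e: "e \<in> parcs G" "fst e = u" "apath (snd e) es v"
    "u \<notin> set (awalk_verts (snd e) es)"
    by (auto simp: apath_Cons_iff)
  from Cons.prems(2) have e': "e' \<in> parcs G" "fst e' = u" "apath (snd e') es' v"
    "u \<notin> set (awalk_verts (snd e') es')"
    by (auto simp: q apath_Cons_iff)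
  show ?case
  proof (cases "e = e'")
    case True
    with Cons.IH[OF e(3)] e'(3) q show ?thesis by simp
  next
    case False
    have awalks: "awalk (snd e) es v" "awalk (snd e') es' v"
      and dist: "distinct (awalk_verts (snd e) es)" "distinct (awalk_verts (snd e') es')"
      using e(3) e'(3) by (auto simp: apath_def)
    then have "v \<in> set (awalk_verts (snd e) es)" "v \<in> set (awalk_verts (snd e') es')"
      by (metis awalk_verts_non_Nil awlast_of_awalk last_in_set NOMATCH_def)+
    then have "\<exists>w\<in>set (awalk_verts (snd e) es). w \<in> set (awalk_verts (snd e') es')"
      by blast
    \<comment> \<open>\<open>w\<close> is the first vertex after \<open>u\<close> at which the first
      path meets the second; the common end \<open>v\<close> ensures that there is one.\<close>
    then obtain xs w ys where xs: "awalk_verts (snd e) es = xs @ w # ys"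
      "w \<in> set (awalk_verts (snd e') es')" "\<forall>x\<in>set xs. x \<notin> set (awalk_verts (snd e') es')"
      by (rule split_list_first_propE)
    then obtain xs' ys' where xs': "awalk_verts (snd e') es' = xs' @ w # ys'"
      by (meson split_list)
    obtain p1 p2 where p1: "es = p1 @ p2" "cas (snd e) p1 w" "awalk_verts (snd e) p1 = xs @ [w]"
      using awalk_decomp_verts[of "snd e" es v xs w ys] awalks(1) xs(1) by blast
    obtain q1 q2 where q1: "es' = q1 @ q2" "cas (snd e') q1 w" "awalk_verts (snd e') q1 = xs' @ [w]"
      using awalk_decomp_verts[of "snd e'" es' v xs' w ys'] awalks(2) xs' by blast
    have w1: "awalk u (e # p1) w"
      using e p1 awalks(1) by (auto simp: awalk_def intro: arc_fst_in_verts)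
    have w2: "awalk u (e' # q1) w"
      using e' q1 awalks(2) by (auto simp: awalk_def intro: arc_fst_in_verts)
    define c where "c = (e # p1) @ rev_path (e' # q1)"
    have "awalk w (rev_path (e' # q1)) u"
      using w2 by (simp only: awalk_rev_path)
    with w1 have walk: "awalk u c u"
      unfolding c_def by (rule awalk_appendI)
    have "awalk_verts w (rev_path (e' # q1)) = rev (u # xs' @ [w])"
      using awalk_verts_rev_path[OF w2] e'(2) q1(3) by simp
    moreover have "awlast u (e # p1) = w"
      using p1(3) by simp
    ultimately have verts: "awalk_verts u c = u # xs @ [w] @ rev xs' @ [u]"
      using awalk_verts_append[OF walk[unfolded c_def]] e(2) p1(3) by (simp add: c_def)
    \<comment> \<open>\<open>xs\<close> misses the second path by the choice of \<open>w\<close>,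
      and \<open>u\<close> recurs on neither path.\<close>
    have "distinct (tl (awalk_verts u c))"
      using dist e(4) e'(4) xs xs' unfolding verts by auto
    with walk have "cycle c"
      unfolding cycle_def by (auto simp: c_def)
    \<comment> \<open>Only the walk along an edge and back is left. Then both paths step directly
      from \<open>u\<close> to \<open>w\<close>, and an arc, being a pair, is determined by its
      ends.\<close>
    with acyclic have "length c < 3"
      by (meson not_le)
    then have "p1 = []" "q1 = []"
      by (auto simp: c_def)
    with p1(2) q1(2) e(2) e'(2) have "e = e'"
      by (auto simp: prod_eq_iff)
    with False show ?thesis by simp
  qed
qed

section \<open>Levels of a rooted homogeneous tree\<close>

locale rooted_homogeneous_tree =
  fixes T :: "'v pair_pre_digraph" and r :: 'v and d :: nat
  assumes homogeneous: "homogeneous_tree d T" and degree_pos: "d > 0" and root: "r \<in> pverts T"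
begin

sublocale pair_bidirected_digraph T
  using homogeneous by (simp add: homogeneous_tree_def undirected_tree_def)

lemma root_apath_unique: "apath r es v \<Longrightarrow> apath r es' v \<Longrightarrow> es = es'"
  using apath_unique homogeneous by (auto simp: homogeneous_tree_def undirected_tree_def)

lemma depth_eq: "apath r es v \<Longrightarrow> depth T r v = length es"
  unfolding depth_def using root_apath_unique by blast

lemma apath_from_root:
  assumes "v \<in> pverts T"
  obtains es where "apath r es v"
proof -
  \<comment> \<open>\<open>connected\<close> ignores directions; the symmetry of the arcs turns it
    into directed reachability.\<close>
  have "strongly_connected (with_proj T)"
    using homogeneous sym_arcs symmetric_connected_imp_strongly_connected
    by (auto simp: homogeneous_tree_def undirected_tree_def)
  then have "r \<rightarrow>\<^sup>*\<^bsub>with_proj T\<^esub> v"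
    using root assms by (auto simp: strongly_connected_def)
  then show thesis
    using that reachable_apath by blast
qed

text \<open>Replaces the definite description in \<open>depth\<close> by the existence of a path, so
  that levels can be handled by extending and cutting paths.\<close>

lemma in_level_iff: "v \<in> level T r n \<longleftrightarrow> (\<exists>es. apath r es v \<and> length es = n)"
proof
  assume "v \<in> level T r n"
  then show "\<exists>es. apath r es v \<and> length es = n"
    using apath_from_root depth_eq unfolding level_def by (metis (mono_tags, lifting) mem_Collect_eq)
next
  assume "\<exists>es. apath r es v \<and> length es = n"
  then show "v \<in> level T r n"
    using depth_eq awalk_last_in_verts unfolding level_def apath_def by blast
qed

lemma level_0: "level T r 0 = {r}"
  using root by (auto simp: in_level_iff apath_Nil_iff)

text \<open>Removing the last arc of a path from the root leaves a path from the root. Both the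
  finiteness and the nonemptiness of the levels come from this inclusion.\<close>

lemma level_Suc_subset:
  "level T r (Suc n) \<subseteq> (\<Union>u\<in>level T r n. snd ` out_arcs (with_proj T) u)"
proof
  fix v assume "v \<in> level T r (Suc n)"
  then obtain es where es: "apath r es v" "length es = Suc n"
    by (auto simp: in_level_iff)
  then obtain es' e where e: "es = es' @ [e]" "length es' = n"
    by (metis length_Suc_conv_rev)
  with es(1) obtain u where "apath r es' u" "apath u [e] v"
    by (auto simp only: apath_append_iff)
  then have "fst e \<in> level T r n" "e \<in> out_arcs (with_proj T) (fst e)" "v = snd e"
    using e(2) by (auto simp: apath_simps in_level_iff out_arcs_def)
  then show "v \<in> (\<Union>u\<in>level T r n. snd ` out_arcs (with_proj T) u)"
    by blast
qed

lemma finite_level: "finite (level T r n)"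
proof (induction n)
  case 0
  then show ?case by (simp add: level_0)
next
  case (Suc n)
  \<comment> \<open>An infinite set has cardinality 0 by convention, so a positive out-degree
    implies finiteness.\<close>
  have "finite (out_arcs (with_proj T) u)" if "u \<in> level T r n" for u
    using that homogeneous degree_pos card.infinite
    by (fastforce simp: homogeneous_tree_def level_def out_degree_def)
  with Suc show ?case
    by (intro finite_subset[OF level_Suc_subset]) auto
qed

text \<open>An empty level would make all later ones empty, leaving only finitely many finite levels
  to cover the vertices.\<close>

lemma level_nonempty:
  assumes "infinite (pverts T)"
  shows "level T r n \<noteq> {}"
proof
  assume empty: "level T r n = {}"
  have "level T r m = {}" if "n \<le> m" for m
    using that
  proof (induction m rule: dec_induct)
    case (step m)
    then show ?case using level_Suc_subset[of m] by simp
  qed (rule empty)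
  then have "pverts T \<subseteq> (\<Union>m<n. level T r m)"
    unfolding level_def by (auto simp: not_less[symmetric]) 
  then show False
    using assms finite_level by (meson finite_UN finite_lessThan finite_subset)
qed

end

section \<open>Minkowski's inequality for finite sums\<close>

text \<open>Convexity of the power function with the endpoint 0 included. If one argument is 0, the
  claim reduces to \<open>s powr p \<le> s\<close> for \<open>s\<close> between 0 and 1.\<close>

lemma convex_powr_nonneg:
  fixes x y t p :: real
  assumes "1 \<le> p" "0 \<le> x" "0 \<le> y" "0 \<le> t" "t \<le> 1"
  shows "(t * x + (1 - t) * y) powr p \<le> t * x powr p + (1 - t) * y powr p"
proof -
  have shrink: "(s * z) powr p \<le> s * z powr p" if "0 \<le> s" "s \<le> 1" "0 \<le> z" for s z :: real
  proof -
    have "s powr p \<le> s"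
      using that assms(1) powr_mono'[of 1 p s] by simp
    with that show ?thesis
      by (simp add: powr_mult mult_right_mono)
  qed
  consider "x = 0" | "y = 0" | "0 < x" "0 < y"
    using assms by linarith
  then show ?thesis
  proof cases
    case 3
    then show ?thesis
      using convex_onD[OF powr_convex[OF assms(1)], of t y x] assms by (simp add: add.commute)
  qed (use assms shrink[of t x] shrink[of "1 - t" y] in auto)
qed

lemma Minkowski_sum:
  fixes f g :: "'a \<Rightarrow> real"
  assumes "finite A" "1 \<le> p"
    and nonneg: "\<And>i. i \<in> A \<Longrightarrow> 0 \<le> f i" "\<And>i. i \<in> A \<Longrightarrow> 0 \<le> g i"
  shows "(\<Sum>i\<in>A. (f i + g i) powr p) powr (1 / p)
           \<le> (\<Sum>i\<in>A. f i powr p) powr (1 / p) + (\<Sum>i\<in>A. g i powr p) powr (1 / p)"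
proof -
  define F where "F = (\<Sum>i\<in>A. f i powr p) powr (1 / p)"
  define G where "G = (\<Sum>i\<in>A. g i powr p) powr (1 / p)"
  have F: "0 \<le> F" "F powr p = (\<Sum>i\<in>A. f i powr p)"
    using assms by (auto simp: F_def powr_powr sum_nonneg)
  have G: "0 \<le> G" "G powr p = (\<Sum>i\<in>A. g i powr p)"
    using assms by (auto simp: G_def powr_powr sum_nonneg)
  \<comment> \<open>The normalization below divides by \<open>F\<close> and \<open>G\<close>; if one
    of them is 0, the corresponding function vanishes on \<open>A\<close>.\<close>
  consider "F = 0" | "G = 0" | "0 < F" "0 < G"
    using F(1) G(1) by linarith
  then have "(\<Sum>i\<in>A. (f i + g i) powr p) powr (1 / p) \<le> F + G"
  proof cases
    case 1
    then have "f i = 0" if "i \<in> A" for i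
      using F(2) assms(1,2) that by (simp add: sum_nonneg_eq_0_iff)
    then show ?thesis
      using 1 by (simp add: G_def cong: sum.cong)
  next
    case 2
    then have "g i = 0" if "i \<in> A" for i
      using G(2) assms(1,2) that by (simp add: sum_nonneg_eq_0_iff)
    then show ?thesis
      using 2 by (simp add: F_def cong: sum.cong)
  next
    case 3
    \<comment> \<open>With this weight, \<open>f + g\<close> is \<open>F + G\<close> times a convex
      combination of the normalized functions \<open>f / F\<close> and \<open>g / G\<close>.\<close>
    define t where "t = F / (F + G)"
    have t: "0 \<le> t" "t \<le> 1" "(F + G) * t = F" "(F + G) * (1 - t) = G"
      using 3 by (auto simp: t_def field_simps)
    have "(\<Sum>i\<in>A. (f i + g i) powr p)
        \<le> (\<Sum>i\<in>A. (F + G) powr p * (t * (f i powr p / F powr p) + (1 - t) * (g i powr p / G powr p)))"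
    proof (rule sum_mono)
      fix i assume i: "i \<in> A"
      have "f i + g i = (F + G) * (t * (f i / F) + (1 - t) * (g i / G))"
        using t 3 by (simp only: distrib_left mult.assoc[symmetric] t(3,4)) simp
      then have "(f i + g i) powr p = (F + G) powr p * (t * (f i / F) + (1 - t) * (g i / G)) powr p"
        using 3 t nonneg i by (simp add: powr_mult)
      also have "\<dots> \<le> (F + G) powr p * (t * (f i / F) powr p + (1 - t) * (g i / G) powr p)"
        using 3 t nonneg i assms(2) by (intro mult_left_mono convex_powr_nonneg) auto
      finally show "(f i + g i) powr p
          \<le> (F + G) powr p * (t * (f i powr p / F powr p) + (1 - t) * (g i powr p / G powr p))"
        using 3 nonneg i by (simp add: powr_divide)
    qed
    also have "\<dots> = (F + G) powr p * (t * ((\<Sum>i\<in>A. f i powr p) / F powr p)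
        + (1 - t) * ((\<Sum>i\<in>A. g i powr p) / G powr p))"
      by (simp add: sum_distrib_left[symmetric] sum.distrib sum_divide_distrib[symmetric])
    \<comment> \<open>The normalized sums are both 1, and the weights add up to 1.\<close>
    also have "\<dots> = (F + G) powr p"
      using 3 by (simp add: F(2)[symmetric] G(2)[symmetric])
    finally have "(\<Sum>i\<in>A. (f i + g i) powr p) powr (1 / p) \<le> ((F + G) powr p) powr (1 / p)"
      using assms(2) by (intro powr_mono2) (auto intro: sum_nonneg)
    then show ?thesis
      using 3 assms(2) by (simp add: powr_powr)
  qed
  then show ?thesis
    by (simp add: F_def G_def)
qed

section \<open>The means over a fixed level as norms\<close>

text \<open>Collects the facts about levels on which the functional analysis rests, separating it
  from the graph theory.\<close>

locale level_means =
  fixes T :: "'v pair_pre_digraph" and r :: 'v and q :: nat and p :: ennreal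
  assumes q_pos: "q \<ge> 1" and p_ge_1: "1 \<le> p"
    and finite_level: "finite (level T r n)"
    and level_nonempty: "level T r n \<noteq> {}"
    and level_0: "level T r 0 = {r}"
begin

abbreviation "M \<equiv> Mp T r q p"

lemma Mp_infinity: "p = \<infinity> \<Longrightarrow> M n f = Max ((\<lambda>v. norm (f v)) ` level T r n)"
  by (simp add: Mp_def level_0)

lemma enn2real_ge_1: "p \<noteq> \<infinity> \<Longrightarrow> 1 \<le> enn2real p"
  using p_ge_1 enn2real_mono[of 1 p] by (simp add: less_top)

text \<open>The factor \<open>c\<close> depends on \<open>n\<close> but not on \<open>f\<close>.
  Taking \<open>c = 1\<close> at the root, where the level is a single vertex, lets level 0 be
  treated like the others.\<close>

lemma Mp_finite:
  assumes "p \<noteq> \<infinity>"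
  obtains c where "c > 0"
    "\<And>f. M n f = (c * (\<Sum>v\<in>level T r n. norm (f v) powr enn2real p)) powr (1 / enn2real p)"
proof (cases "n = 0")
  case True
  then show thesis
    using that[of 1] enn2real_ge_1[OF assms] by (simp add: Mp_def level_0 powr_powr)
next
  case False
  then show thesis
    using that[of "1 / ((real q + 1) * real q ^ (n - 1))"] q_pos assms by (simp add: Mp_def)
qed

lemma Mp_nonneg: "0 \<le> M n f"
proof (cases "p = \<infinity>")
  case True
  show ?thesis
    using finite_level level_nonempty by (auto simp: Mp_infinity[OF True] Max_ge_iff)
next
  case False
  then show ?thesis
    by (rule Mp_finite[where n = n]) simp
qed

lemma Mp_cmult: "M n (\<lambda>v. a * f v) = norm a * M n f"
proof (cases "p = \<infinity>")
  case True
  have "mono (\<lambda>x. norm a * x)"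
    by (simp add: monoI mult_left_mono)
  then show ?thesis
    using mono_Max_commute[of "\<lambda>x. norm a * x" "(\<lambda>v. norm (f v)) ` level T r n"]
      finite_level level_nonempty
    by (simp add: Mp_infinity[OF True] norm_mult image_image)
next
  case False
  then show ?thesis
  proof (rule Mp_finite)
    fix c :: real
    assume c: "c > 0"
      "\<And>f. M n f = (c * (\<Sum>v\<in>level T r n. norm (f v) powr enn2real p)) powr (1 / enn2real p)"
    have "c * (\<Sum>v\<in>level T r n. norm (a * f v) powr enn2real p) =
        norm a powr enn2real p * (c * (\<Sum>v\<in>level T r n. norm (f v) powr enn2real p))"
      by (simp add: norm_mult powr_mult sum_distrib_left mult_ac)
    then show ?thesis
      using c(1) enn2real_ge_1[OF False] by (simp add: c(2) powr_mult powr_powr sum_nonneg)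
  qed
qed

lemma Mp_add: "M n (\<lambda>v. f v + g v) \<le> M n f + M n g"
proof (cases "p = \<infinity>")
  case True
  have "norm (f v + g v) \<le> M n f + M n g" if "v \<in> level T r n" for v
  proof -
    have "norm (f v) \<le> M n f" "norm (g v) \<le> M n g"
      using that finite_level by (auto simp: Mp_infinity[OF True])
    then show ?thesis
      using norm_triangle_ineq[of "f v" "g v"] by linarith
  qed
  then show ?thesis
    using finite_level level_nonempty by (subst Mp_infinity[OF True]) auto
next
  case False
  define P where "P = enn2real p"
  have P: "1 \<le> P"
    using enn2real_ge_1 False by (simp add: P_def)
  obtain c where c: "c > 0"
      "\<And>f. M n f = (c * (\<Sum>v\<in>level T r n. norm (f v) powr P)) powr (1 / P)"
    using Mp_finite[OF False] unfolding P_def by blast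
  have M: "M n f = c powr (1 / P) * (\<Sum>v\<in>level T r n. norm (f v) powr P) powr (1 / P)" for f
    using c(1) by (simp add: c(2) powr_mult sum_nonneg)
  have "(\<Sum>v\<in>level T r n. norm (f v + g v) powr P) powr (1 / P)
      \<le> (\<Sum>v\<in>level T r n. (norm (f v) + norm (g v)) powr P) powr (1 / P)"
    using P by (intro powr_mono2 sum_mono sum_nonneg norm_triangle_ineq) auto
  also have "\<dots> \<le> (\<Sum>v\<in>level T r n. norm (f v) powr P) powr (1 / P)
      + (\<Sum>v\<in>level T r n. norm (g v) powr P) powr (1 / P)"
    using P finite_level by (intro Minkowski_sum) auto
  finally show ?thesis
    unfolding M by (simp add: distrib_left[symmetric] mult_left_mono)
qed

text \<open>A single term is at most the whole sum, so \<open>C\<close> comes from undoing the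
  factor in \<open>Mp_finite\<close>. This yields definiteness of the norm and convergence at each
  vertex.\<close>

lemma norm_le_Mp: "\<exists>C>0. \<forall>f. \<forall>v\<in>level T r n. norm (f v) \<le> C * M n f"
proof (cases "p = \<infinity>")
  case True
  show ?thesis
    using finite_level by (intro exI[of _ 1]) (auto simp: Mp_infinity[OF True])
next
  case False
  define P where "P = enn2real p"
  have P: "1 \<le> P"
    using enn2real_ge_1 False by (simp add: P_def)
  obtain c where c: "c > 0"
      "\<And>f. M n f = (c * (\<Sum>v\<in>level T r n. norm (f v) powr P)) powr (1 / P)"
    using Mp_finite[OF False] unfolding P_def by blast
  have "norm (f v) \<le> (1 / c) powr (1 / P) * M n f" if "v \<in> level T r n" for f v
  proof -
    have "norm (f v) powr P \<le> (\<Sum>v\<in>level T r n. norm (f v) powr P)"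
      using that finite_level by (intro member_le_sum) auto
    then have "(norm (f v) powr P) powr (1 / P) \<le> (\<Sum>v\<in>level T r n. norm (f v) powr P) powr (1 / P)"
      using P by (intro powr_mono2) auto
    then have "norm (f v) \<le> (\<Sum>v\<in>level T r n. norm (f v) powr P) powr (1 / P)"
      using P by (simp add: powr_powr)
    then show ?thesis
      using c(1) by (simp add: c(2) powr_mult[symmetric] sum_nonneg)
  qed
  then show ?thesis
    using c(1) by (intro exI[of _ "(1 / c) powr (1 / P)"]) auto
qed

text \<open>For infinite \<open>p\<close> the bound passes to the limit vertex by vertex; for finite
  \<open>p\<close> the mean is a continuous function of the finitely many values on the
  level.\<close>

lemma Mp_le_of_pointwise_limit:
  assumes lim: "\<And>v. v \<in> level T r n \<Longrightarrow> (\<lambda>k. F k v) \<longlonglongrightarrow> f v"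
    and bound: "\<And>k. k \<ge> N \<Longrightarrow> M n (F k) \<le> B"
  shows "M n f \<le> B"
proof (cases "p = \<infinity>")
  case True
  have "norm (F k v) \<le> B" if "v \<in> level T r n" "k \<ge> N" for v k
    using bound[OF that(2)] that(1) finite_level level_nonempty by (simp add: Mp_infinity[OF True])
  then have "norm (f v) \<le> B" if "v \<in> level T r n" for v
    using that by (intro LIMSEQ_le_const2[OF tendsto_norm[OF lim[OF that]]]) blast
  then show ?thesis
    using finite_level level_nonempty by (auto simp: Mp_infinity[OF True])
next
  case False
  define P where "P = enn2real p"
  have P: "1 \<le> P"
    using enn2real_ge_1 False by (simp add: P_def)
  obtain c where c: "c > 0"
      "\<And>f. M n f = (c * (\<Sum>v\<in>level T r n. norm (f v) powr P)) powr (1 / P)"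
    using Mp_finite[OF False] unfolding P_def by blast
  \<comment> \<open>The limit of a base may be 0; the power is still continuous there, since the
    bases are nonnegative and the exponent is positive.\<close>
  have "(\<lambda>k. \<Sum>v\<in>level T r n. norm (F k v) powr P) \<longlonglongrightarrow> (\<Sum>v\<in>level T r n. norm (f v) powr P)"
    using P by (intro tendsto_sum tendsto_powr' tendsto_norm lim) auto
  then have "(\<lambda>k. M n (F k)) \<longlonglongrightarrow> M n f"
    using P c(1) unfolding c(2)
    by (intro tendsto_powr' tendsto_mult tendsto_const) (auto simp: sum_nonneg)
  then show ?thesis
    using bound by (intro LIMSEQ_le_const2) auto
qed

section \<open>The supremum norm over the levels\<close>

abbreviation "N f \<equiv> enn2real (Tnorm T r q p f)"

lemma Mp_zero: "M n 0 = 0"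
  using Mp_cmult[of n 0 "\<lambda>_. 0"] by (simp add: zero_fun_def)

lemma Mp_plus: "M n (f + g) \<le> M n f + M n g"
  using Mp_add[of n f g] by (simp add: plus_fun_def)

lemma Mp_minus_commute: "M n (f - g) = M n (g - f)"
  using Mp_cmult[of n "-1" "f - g"] by (simp add: fun_diff_def)

text \<open>Stated for arbitrary functions because \<open>Metric_space\<close> asks for symmetry
  outside the carrier as well.\<close>

lemma Tnorm_minus_commute: "Tnorm T r q p (f - g) = Tnorm T r q p (g - f)"
  unfolding Tnorm_def using Mp_minus_commute by simp

lemma Tnorm_le:
  assumes "\<And>n. M n f \<le> B"
  shows "Tnorm T r q p f \<le> ennreal B"
  unfolding Tnorm_def using assms by (intro SUP_least ennreal_leI)

lemma N_le:
  assumes "\<And>n. M n f \<le> B"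
  shows "N f \<le> B"
  using Tnorm_le[OF assms] Mp_nonneg[of 0 f] assms[of 0] by (intro enn2real_leI) auto

text \<open>Membership in \<open>Tp\<close> makes the supremum finite; \<open>enn2real\<close> would
  send an infinite one to 0.\<close>

lemma Mp_le_N:
  assumes "f \<in> Tp T r q p"
  shows "M n f \<le> N f"
proof -
  have "ennreal (M n f) \<le> Tnorm T r q p f"
    unfolding Tnorm_def by (intro SUP_upper) simp
  then have "enn2real (ennreal (M n f)) \<le> N f"
    using assms by (intro enn2real_mono) (auto simp: Tp_def)
  then show ?thesis
    using Mp_nonneg by simp
qed

text \<open>A convergent sequence is bounded, which supplies the finiteness of \<open>Tnorm\<close>;
  membership proofs thus reduce to the limit.\<close>

lemma Tp0_iff: "f \<in> Tp0 T r q p \<longleftrightarrow> f \<in> vertex_functions T \<and> (\<lambda>n. M n f) \<longlonglongrightarrow> 0"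
proof -
  have "Tnorm T r q p f < \<infinity>" if lim: "(\<lambda>n. M n f) \<longlonglongrightarrow> 0"
  proof -
    obtain B where "\<And>n. norm (M n f) \<le> B"
      using convergent_imp_Bseq[OF convergentI[OF lim]] by (auto simp: Bseq_def)
    then have "Tnorm T r q p f \<le> ennreal B"
      by (intro Tnorm_le) (auto intro: order_trans[OF abs_ge_self])
    then show ?thesis
      using le_less_trans by fastforce
  qed
  then show ?thesis
    by (auto simp: Tp0_def Tp_def)
qed

lemma subspace_Tp0: "module.subspace (\<lambda>c f v. c * f v) (Tp0 T r q p)"
proof -
  interpret vector_space "\<lambda>(c::complex) (f::'v \<Rightarrow> complex) v. c * f v"
    by unfold_locales (auto simp: fun_eq_iff algebra_simps)
  show ?thesis
  proof (rule subspaceI)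
    show "0 \<in> Tp0 T r q p"
      by (simp add: Tp0_iff vertex_functions_def Mp_zero)
  next
    fix f g assume "f \<in> Tp0 T r q p" "g \<in> Tp0 T r q p"
    then have fg: "f + g \<in> vertex_functions T" "(\<lambda>n. M n f) \<longlonglongrightarrow> 0" "(\<lambda>n. M n g) \<longlonglongrightarrow> 0"
      by (auto simp: Tp0_iff vertex_functions_def)
    have "(\<lambda>n. M n (f + g)) \<longlonglongrightarrow> 0"
    proof (rule tendsto_sandwich[OF _ _ tendsto_const])
      show "(\<lambda>n. M n f + M n g) \<longlonglongrightarrow> 0"
        using tendsto_add[OF fg(2,3)] by simp
    qed (simp_all add: Mp_plus Mp_nonneg)
    with fg(1) show "f + g \<in> Tp0 T r q p"
      by (simp add: Tp0_iff)
  next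
    fix c and f assume "f \<in> Tp0 T r q p"
    then show "(\<lambda>v. c * f v) \<in> Tp0 T r q p"
      by (auto simp: Tp0_iff vertex_functions_def Mp_cmult intro: tendsto_mult_right_zero)
  qed
qed

lemma diff_Tp0:
  assumes "f \<in> Tp0 T r q p" "g \<in> Tp0 T r q p"
  shows "f - g \<in> Tp0 T r q p"
proof -
  interpret vector_space "\<lambda>(c::complex) (f::'v \<Rightarrow> complex) v. c * f v"
    by unfold_locales (auto simp: fun_eq_iff algebra_simps)
  show ?thesis
    using subspace_diff[OF subspace_Tp0 assms] .
qed

lemma Tp0_subset_Tp: "Tp0 T r q p \<subseteq> Tp T r q p"
  by (auto simp: Tp0_def)

text \<open>The factor leaves the supremum within \<open>ennreal\<close>. Where the supremum is
  infinite, both sides are 0.\<close>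

lemma N_cmult: "N (\<lambda>v. c * f v) = norm c * N f"
  by (simp add: Tnorm_def Mp_cmult ennreal_mult Mp_nonneg SUP_mult_left_ennreal[symmetric] enn2real_mult)

lemma norm_on_Tp0: "norm_on (\<lambda>c f v. c * f v) (Tp0 T r q p) N"
proof -
  have "N f = 0 \<longleftrightarrow> f = 0" if f: "f \<in> Tp0 T r q p" for f
  proof
    assume "N f = 0"
    then have "M n f = 0" for n
      using Mp_le_N[of f n] Mp_nonneg[of n f] f Tp0_subset_Tp by auto
    then have "f v = 0" if "v \<in> level T r n" for v n
      using norm_le_Mp[of n] that by (metis mult_zero_right norm_le_zero_iff)
    then have "f v = 0" for v
      using f by (cases "v \<in> pverts T") (auto simp: level_def Tp0_iff vertex_functions_def)
    then show "f = 0"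
      by (simp add: fun_eq_iff)
  next
    assume "f = 0"
    then show "N f = 0"
      by (simp add: Tnorm_def Mp_zero)
  qed
  moreover have "N (f + g) \<le> N f + N g" if "f \<in> Tp0 T r q p" "g \<in> Tp0 T r q p" for f g
    using that Tp0_subset_Tp by (intro N_le order_trans[OF Mp_plus] add_mono Mp_le_N) auto
  ultimately show ?thesis
    unfolding norm_on_def by (simp add: N_cmult)
qed

lemma metric_Tp0: "Metric_space (Tp0 T r q p) (\<lambda>f g. N (f - g))"
proof
  fix f g h assume "f \<in> Tp0 T r q p" "g \<in> Tp0 T r q p" "h \<in> Tp0 T r q p"
  then have "f - g \<in> Tp0 T r q p" "g - h \<in> Tp0 T r q p"
    by (auto intro: diff_Tp0)
  then have "N ((f - g) + (g - h)) \<le> N (f - g) + N (g - h)"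
    using norm_on_Tp0 unfolding norm_on_def by blast
  then show "N (f - h) \<le> N (f - g) + N (g - h)"
    by simp
next
  fix f g assume "f \<in> Tp0 T r q p" "g \<in> Tp0 T r q p"
  then have "N (f - g) = 0 \<longleftrightarrow> f - g = 0"
    using norm_on_Tp0 diff_Tp0 unfolding norm_on_def by blast
  then show "N (f - g) = 0 \<longleftrightarrow> f = g"
    by simp
qed (simp_all add: Tnorm_minus_commute)

section \<open>Completeness\<close>

text \<open>The constant \<open>C\<close> of \<open>norm_le_Mp\<close> belongs to the level of
  \<open>v\<close>, so the tolerance \<open>e / C\<close> varies with the level. Outside the tree
  all values are 0.\<close>

lemma Cauchy_pointwise:
  assumes "\<And>k. F k \<in> Tp0 T r q p"
    and Cauchy: "\<And>e. e > 0 \<Longrightarrow> \<exists>K. \<forall>j\<ge>K. \<forall>k\<ge>K. N (F j - F k) < e"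
  shows "Cauchy (\<lambda>k. F k v)"
proof (cases "v \<in> pverts T")
  case True
  then have v: "v \<in> level T r (depth T r v)"
    by (simp add: level_def)
  obtain C where C: "C > 0" "\<And>f. norm (f v) \<le> C * M (depth T r v) f"
    using norm_le_Mp v by blast
  show ?thesis
  proof (rule CauchyI)
    fix e :: real assume "0 < e"
    then obtain K where K: "\<And>j k. j \<ge> K \<Longrightarrow> k \<ge> K \<Longrightarrow> N (F j - F k) < e / C"
      using Cauchy[of "e / C"] C(1) by auto
    have "norm (F j v - F k v) < e" if "j \<ge> K" "k \<ge> K" for j k
    proof -
      have "norm (F j v - F k v) \<le> C * M (depth T r v) (F j - F k)"
        using C(2)[of "F j - F k"] by simp
      also have "\<dots> \<le> C * N (F j - F k)"
        using C(1) assms(1) diff_Tp0 Tp0_subset_Tp by (intro mult_left_mono Mp_le_N) auto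
      also have "\<dots> < e"
        using K[OF that] C(1) by (simp add: field_simps)
      finally show ?thesis .
    qed
    then show "\<exists>K. \<forall>j\<ge>K. \<forall>k\<ge>K. norm (F j v - F k v) < e"
      by blast
  qed
next
  case False
  then have "F k v = 0" for k
    using assms(1)[of k] by (simp add: Tp0_iff vertex_functions_def)
  then show ?thesis
    by (simp add: Cauchy_def)
qed

lemma mcomplete_Tp0: "Metric_space.mcomplete (Tp0 T r q p) (\<lambda>f g. N (f - g))"
proof -
  interpret Metric_space "Tp0 T r q p" "\<lambda>f g. N (f - g)"
    by (rule metric_Tp0)
  show ?thesis
    unfolding mcomplete_def
  proof (intro allI impI)
    fix F assume "MCauchy F"
    then have "range F \<subseteq> Tp0 T r q p"
      and Cauchy: "\<And>e. e > 0 \<Longrightarrow> \<exists>K. \<forall>j\<ge>K. \<forall>k\<ge>K. N (F j - F k) < e"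
      unfolding MCauchy_def by simp_all
    then have F: "F k \<in> Tp0 T r q p" for k
      by blast
    define g where "g v = lim (\<lambda>k. F k v)" for v
    have lim: "(\<lambda>k. F k v) \<longlonglongrightarrow> g v" for v
      unfolding g_def
      by (intro convergent_LIMSEQ_iff[THEN iffD1] Cauchy_convergent Cauchy_pointwise F Cauchy)
    \<comment> \<open>Here \<open>K\<close> is chosen before \<open>n\<close>. For fixed
      \<open>k\<close>, letting \<open>j\<close> tend to infinity in the bound for
      \<open>F k - F j\<close> gives a bound, no longer strict, on every level at once.\<close>
    have close: "\<exists>K. \<forall>k\<ge>K. \<forall>n. M n (F k - g) \<le> e" if e: "e > 0" for e
    proof -
      obtain K where K: "\<And>j k. j \<ge> K \<Longrightarrow> k \<ge> K \<Longrightarrow> N (F j - F k) < e"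
        using Cauchy[OF e] by blast
      have "M n (F k - g) \<le> e" if "k \<ge> K" for k n
      proof (rule Mp_le_of_pointwise_limit)
        show "(\<lambda>j. (F k - F j) v) \<longlonglongrightarrow> (F k - g) v" for v
          by (auto intro!: tendsto_diff lim)
        show "M n (F k - F j) \<le> e" if "j \<ge> K" for j
        proof -
          have "F k - F j \<in> Tp T r q p"
            using diff_Tp0[OF F F] Tp0_subset_Tp by blast
          then show ?thesis
            using Mp_le_N[of "F k - F j" n] K[OF \<open>k \<ge> K\<close> that] by linarith
        qed
      qed
      then show ?thesis
        by blast
    qed
    have "g \<in> vertex_functions T"
      using F by (auto simp: vertex_functions_def Tp0_iff g_def)
    moreover have "(\<lambda>n. M n g) \<longlonglongrightarrow> 0"
    proof (rule LIMSEQ_I)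
      fix e :: real assume "0 < e"
      \<comment> \<open>One \<open>k\<close> serves all levels; the decay of the means of this
        single \<open>F k\<close> then carries over to \<open>g\<close>.\<close>
      then obtain k where k: "\<And>n. M n (F k - g) \<le> e / 2"
        using close[of "e / 2"] by auto
      have "(\<lambda>n. M n (F k)) \<longlonglongrightarrow> 0"
        using F by (simp add: Tp0_iff)
      then obtain n0 where n0: "\<And>n. n \<ge> n0 \<Longrightarrow> norm (M n (F k) - 0) < e / 2"
        using LIMSEQ_D[of "\<lambda>n. M n (F k)" 0 "e / 2"] \<open>0 < e\<close> by auto
      have "norm (M n g - 0) < e" if "n \<ge> n0" for n
      proof -
        have "M n g \<le> M n (F k) + M n (g - F k)"
          using Mp_plus[of n "F k" "g - F k"] by simp
        also have "\<dots> < e"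
          using n0[OF that] k[of n] by (simp add: Mp_minus_commute[of n g])
        finally show ?thesis
          using Mp_nonneg by simp
      qed
      then show "\<exists>n0. \<forall>n\<ge>n0. norm (M n g - 0) < e"
        by blast
    qed
    ultimately have "g \<in> Tp0 T r q p"
      by (simp add: Tp0_iff)
    moreover have "\<exists>K. \<forall>k\<ge>K. F k \<in> Tp0 T r q p \<and> N (F k - g) < e" if e: "e > 0" for e
    proof -
      \<comment> \<open>Halving \<open>e\<close> restores the strict inequality after passing to the
        supremum over \<open>n\<close>.\<close>
      obtain K where K: "\<And>k n. k \<ge> K \<Longrightarrow> M n (F k - g) \<le> e / 2"
        using close[OF half_gt_zero[OF e]] by blast
      have "N (F k - g) < e" if "k \<ge> K" for k
      proof -
        have "N (F k - g) \<le> e / 2"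
          by (intro N_le K that)
        with e show ?thesis
          by linarith
      qed
      then show ?thesis
        using F by blast
    qed
    ultimately show "\<exists>g. limitin mtopology F g sequentially"
      unfolding limit_metric_sequentially by (intro exI[of _ g] conjI allI impI)
  qed
qed

lemma complex_banach_Tp0: "complex_banach_on (\<lambda>c f v. c * f v) (Tp0 T r q p) N"
  unfolding complex_banach_on_def
proof (intro conjI)
  show "vector_space (\<lambda>(c::complex) (f::'v \<Rightarrow> complex) v. c * f v)"
    by unfold_locales (auto simp: fun_eq_iff algebra_simps)
qed (rule subspace_Tp0 norm_on_Tp0 mcomplete_Tp0)+

end

theorem theorem2:
  fixes T :: "'v pair_pre_digraph" and r :: 'v and q :: nat and p :: ennreal
  assumes "q \<ge> 1"
    and "homogeneous_tree (q + 1) T"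
    and "infinite (pverts T)"
    and "r \<in> pverts T"
    and "1 \<le> p"
  shows "complex_banach_on (\<lambda>c f v. c * f v) (Tp0 T r q p) (\<lambda>f. enn2real (Tnorm T r q p f))"
proof -
  interpret rooted_homogeneous_tree T r "q + 1"
    using assms by unfold_locales auto
  interpret level_means T r q p
    using assms finite_level level_nonempty level_0 by unfold_locales auto
  show ?thesis
    by (rule complex_banach_Tp0)
qed

end
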